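(* Let $(\mathcal{V},g)$ be a finite-dimensional real vector space with a positive definite scalar product, and let $R$ be an algebraic curvature tensor on $(\mathcal{V},g)$. If $R$ is Osserman and two-root, then $R$ is Jacobi-orthogonal.
   Context: An algebraic curvature tensor on $(\mathcal{V},g)$ is a 4-linear form $R\colon\mathcal{V}^4\to\mathbb{R}$ satisfying $R(X,Y,Z,W)=-R(Y,X,Z,W)=-R(X,Y,W,Z)=R(Z,W,X,Y)$ and the first Bianchi identity $R(X,Y,Z,W)+R(Y,Z,X,W)+R(Z,X,Y,W)=0$ for all $X,Y,Z,W\in\mathcal{V}$. The associated curvature operator $\mathcal{R}$ is defined by $g(\mathcal{R}(X,Y)Z,W)=R(X,Y,Z,W)$. For $X\in\mathcal{V}$, the Jacobi operator is the self-adjoint linear operator $\mathcal{J}_X\colon\mathcal{V}\to\mathcal{V}$, $\mathcal{J}_XY=\mathcal{R}(Y,X)X$. For nonzero $X$, the reduced Jacobi operator $\widetilde{\mathcal{J}}_X\colon X^\perp\to X^\perp$ is the restriction of $\mathcal{J}_X$ to the orthogonal complement $X^\perp$ of $X$. $R$ is Osserman if the characteristic polynomial $\det(\lambda\,\mathrm{Id}-\widetilde{\mathcal{J}}_X)$ is the same for all unit vectors $X\in\mathcal{V}$. $R$ is two-root if $\widetilde{\mathcal{J}}_X$ has exactly $2$ distinct eigenvalues for every nonzero $X\in\mathcal{V}$. $R$ is Jacobi-orthogonal if $g(\mathcal{J}_XY,\mathcal{J}_YX)=0$ for all $X,Y\in\mathcal{V}$ with $g(X,Y)=0$. *)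

theory Defs
  imports
    "HOL-Analysis.Analysis"
    "Jordan_Normal_Form.Char_Poly"
begin

no_notation Matrix.scalar_prod (infix "\<bullet>" 70)

definition ordered_basis :: "'a::euclidean_space list \<Rightarrow> 'a set \<Rightarrow> bool" where
  "ordered_basis bs S \<longleftrightarrow> distinct bs \<and> independent (set bs) \<and> span (set bs) = S"

definition matrix_wrt ::
    "'a::euclidean_space list \<Rightarrow> 'a list \<Rightarrow> ('a \<Rightarrow> 'a) \<Rightarrow> real mat" where
  "matrix_wrt bs cs f =
     mat (length bs) (length cs) (\<lambda>(i, j). representation (set bs) (f (cs ! j)) (bs ! i))"

text \<open>
  For a subspace \<open>S\<close> invariant under \<open>f\<close>, the next two definitions concern the restriction
  \<open>f|S : S \<rightarrow> S\<close>. Its characteristic polynomial \<open>det (\<lambda> Id - f|S)\<close> is computed in any basis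
  of \<open>S\<close>; it does not depend on the choice, see \<open>char_poly_on_eq\<close>.
\<close>

definition char_poly_on :: "'a::euclidean_space set \<Rightarrow> ('a \<Rightarrow> 'a) \<Rightarrow> real poly" where
  "char_poly_on S f = (let bs = SOME bs. ordered_basis bs S in char_poly (matrix_wrt bs bs f))"

definition eigenvalues_on :: "'a::euclidean_space set \<Rightarrow> ('a \<Rightarrow> 'a) \<Rightarrow> real set" where
  "eigenvalues_on S f = {c. \<exists>v\<in>S. v \<noteq> 0 \<and> f v = c *\<^sub>R v}"

lemma ordered_basis_exists:
  assumes "subspace S"
  shows "\<exists>bs. ordered_basis bs S"
proof -
  obtain B where B: "B \<subseteq> S" "independent B" "S \<subseteq> span B"
    using basis_exists[of S] by metis
  obtain bs where "set bs = B" "distinct bs"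
    using finite_distinct_list[OF independent_imp_finite[OF B(2)]] by auto
  moreover have "span B = S"
    using B assms by (metis span_subspace)
  ultimately show ?thesis
    using B by (auto simp: ordered_basis_def)
qed

lemma sum_representation_ordered_basis:
  assumes "ordered_basis bs S" "v \<in> S"
  shows "(\<Sum>i<length bs. representation (set bs) v (bs ! i) *\<^sub>R (bs ! i)) = v"
proof -
  have "(\<Sum>i<length bs. representation (set bs) v (bs ! i) *\<^sub>R (bs ! i)) =
        (\<Sum>b\<in>set bs. representation (set bs) v b *\<^sub>R b)"
    by (rule sum.reindex_bij_betw[OF bij_betw_nth])
       (use assms(1) in \<open>auto simp: ordered_basis_def\<close>)
  also have "\<dots> = v"
    by (rule real_vector.sum_representation_eq) (use assms in \<open>auto simp: ordered_basis_def\<close>)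
  finally show ?thesis .
qed

lemma matrix_wrt_mult:
  assumes bs: "ordered_basis bs S" and cs: "ordered_basis cs S" and ds: "ordered_basis ds S"
    and g: "linear g" "g ` S \<subseteq> S" and h: "h ` S \<subseteq> S"
  shows "matrix_wrt bs cs g * matrix_wrt cs ds h = matrix_wrt bs ds (g \<circ> h)"
proof (rule eq_matI)
  fix i j
  assume "i < dim_row (matrix_wrt bs ds (g \<circ> h))" "j < dim_col (matrix_wrt bs ds (g \<circ> h))"
  then have i: "i < length bs" and j: "j < length ds"
    by (auto simp: matrix_wrt_def)
  have in_span: "set ds \<subseteq> S" "set cs \<subseteq> S"
    using cs ds by (auto simp: ordered_basis_def intro: span_base)
  define v where "v = h (ds ! j)"
  have v: "v \<in> S"
    using subsetD[OF in_span(1) nth_mem[OF j]] h by (auto simp: v_def)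
  define x where "x k = representation (set cs) v (cs ! k)" for k
  have gcs: "g (cs ! k) \<in> span (set bs)" if "k < length cs" for k
    using subsetD[OF in_span(2) nth_mem[OF that]] g(2) bs by (auto simp: ordered_basis_def)
  have ind: "independent (set bs)"
    using bs by (simp add: ordered_basis_def)
  have v_eq: "(\<Sum>k<length cs. x k *\<^sub>R (cs ! k)) = v"
    unfolding x_def by (rule sum_representation_ordered_basis[OF cs v])
  have "g (\<Sum>k<length cs. x k *\<^sub>R (cs ! k)) = (\<Sum>k<length cs. x k *\<^sub>R g (cs ! k))"
    by (simp only: linear_sum[OF g(1)] linear_scale[OF g(1)])
  then have "g v = (\<Sum>k<length cs. x k *\<^sub>R g (cs ! k))"
    by (simp only: v_eq)
  then have "representation (set bs) (g v) =
      representation (set bs) (\<Sum>k<length cs. x k *\<^sub>R g (cs ! k))"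
    by (rule arg_cong)
  also have "\<dots> = (\<lambda>b. \<Sum>k<length cs. representation (set bs) (x k *\<^sub>R g (cs ! k)) b)"
    by (rule real_vector.representation_sum[OF ind]) (auto intro: span_scale gcs)
  also have "\<dots> = (\<lambda>b. \<Sum>k<length cs. x k * representation (set bs) (g (cs ! k)) b)"
    by (intro ext sum.cong refl) (simp add: real_vector.representation_scale[OF ind gcs])
  finally have "representation (set bs) (g v) (bs ! i) =
      (\<Sum>k<length cs. x k * representation (set bs) (g (cs ! k)) (bs ! i))"
    by (rule fun_cong)
  then show "(matrix_wrt bs cs g * matrix_wrt cs ds h) $$ (i, j) =
      matrix_wrt bs ds (g \<circ> h) $$ (i, j)"
    using i j by (simp add: matrix_wrt_def scalar_prod_def x_def v_def lessThan_atLeast0 mult.commute)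
qed (auto simp: matrix_wrt_def)

lemma matrix_wrt_id:
  assumes "ordered_basis bs S"
  shows "matrix_wrt bs bs id = 1\<^sub>m (length bs)"
proof (rule eq_matI)
  fix i j
  assume ij: "i < dim_row (1\<^sub>m (length bs))" "j < dim_col (1\<^sub>m (length bs))"
  have "representation (set bs) (bs ! j) = (\<lambda>b. if b = bs ! j then 1 else 0)"
    using assms ij by (intro real_vector.representation_basis) (auto simp: ordered_basis_def)
  then show "matrix_wrt bs bs id $$ (i, j) = 1\<^sub>m (length bs) $$ (i, j)"
    using assms ij by (simp add: matrix_wrt_def ordered_basis_def nth_eq_iff_index_eq)
qed (simp_all add: matrix_wrt_def)

lemma char_poly_on_eq:
  assumes "linear f" "f ` S \<subseteq> S" "ordered_basis bs S"
  shows "char_poly_on S f = char_poly (matrix_wrt bs bs f)"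
proof -
  define cs where "cs = (SOME cs. ordered_basis cs S)"
  have cs: "ordered_basis cs S"
    unfolding cs_def using assms(3) by (rule someI)
  have len: "length cs = length bs"
  proof -
    have "length xs = dim S" if "ordered_basis xs S" for xs
      using that dim_eq_card_independent[of "set xs"]
      by (auto simp: ordered_basis_def distinct_card dim_span)
    with cs assms(3) show ?thesis by simp
  qed
  note mult = matrix_wrt_mult[where S = S]
  have id: "linear (id :: 'a \<Rightarrow> 'a)" "id ` S \<subseteq> S"
    by (auto intro: linear_id)
  have fid: "(f \<circ> id) ` S \<subseteq> S"
    using assms(2) by simp
  have "similar_mat_wit (matrix_wrt cs cs f) (matrix_wrt bs bs f)
          (matrix_wrt cs bs id) (matrix_wrt bs cs id)"
    unfolding similar_mat_wit_def Let_def
  proof (intro conjI)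
    show "matrix_wrt cs bs id * matrix_wrt bs cs id = 1\<^sub>m (dim_row (matrix_wrt cs cs f))"
      using mult[OF cs assms(3) cs id id(2)] matrix_wrt_id[OF cs] by (simp add: matrix_wrt_def)
    show "matrix_wrt bs cs id * matrix_wrt cs bs id = 1\<^sub>m (dim_row (matrix_wrt cs cs f))"
      using mult[OF assms(3) cs assms(3) id id(2)] matrix_wrt_id[OF assms(3)] len
      by (simp add: matrix_wrt_def)
    show "matrix_wrt cs cs f = matrix_wrt cs bs id * matrix_wrt bs bs f * matrix_wrt bs cs id"
      using mult[OF cs assms(3) assms(3) id assms(2)] mult[OF cs assms(3) cs assms(1,2) id(2)]
      by simp
  qed (auto simp: matrix_wrt_def len)
  then have "similar_mat (matrix_wrt cs cs f) (matrix_wrt bs bs f)"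
    unfolding similar_mat_def by blast
  from char_poly_similar[OF this] show ?thesis
    by (simp add: char_poly_on_def Let_def cs_def)
qed

definition algebraic_curvature_tensor ::
    "('a::euclidean_space \<Rightarrow> 'a \<Rightarrow> 'a \<Rightarrow> 'a \<Rightarrow> real) \<Rightarrow> bool" where
  "algebraic_curvature_tensor R \<longleftrightarrow>
     (\<forall>Y Z W. linear (\<lambda>X. R X Y Z W)) \<and>
     (\<forall>X Z W. linear (\<lambda>Y. R X Y Z W)) \<and>
     (\<forall>X Y W. linear (\<lambda>Z. R X Y Z W)) \<and>
     (\<forall>X Y Z. linear (\<lambda>W. R X Y Z W)) \<and>
     (\<forall>X Y Z W. R X Y Z W = - R Y X Z W) \<and>
     (\<forall>X Y Z W. R X Y Z W = - R X Y W Z) \<and>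
     (\<forall>X Y Z W. R X Y Z W = R Z W X Y) \<and>
     (\<forall>X Y Z W. R X Y Z W + R Y Z X W + R Z X Y W = 0)"

definition curvature_operator ::
    "('a::euclidean_space \<Rightarrow> 'a \<Rightarrow> 'a \<Rightarrow> 'a \<Rightarrow> real) \<Rightarrow> 'a \<Rightarrow> 'a \<Rightarrow> 'a \<Rightarrow> 'a" where
  "curvature_operator R X Y Z = (THE V. \<forall>W. V \<bullet> W = R X Y Z W)"

definition jacobi_operator ::
    "('a::euclidean_space \<Rightarrow> 'a \<Rightarrow> 'a \<Rightarrow> 'a \<Rightarrow> real) \<Rightarrow> 'a \<Rightarrow> 'a \<Rightarrow> 'a" where
  "jacobi_operator R X Y = curvature_operator R Y X X"

definition osserman :: "('a::euclidean_space \<Rightarrow> 'a \<Rightarrow> 'a \<Rightarrow> 'a \<Rightarrow> real) \<Rightarrow> bool" where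
  "osserman R \<longleftrightarrow>
     (\<forall>X Y. norm X = 1 \<longrightarrow> norm Y = 1 \<longrightarrow>
        char_poly_on (orthogonal_comp {X}) (jacobi_operator R X) =
        char_poly_on (orthogonal_comp {Y}) (jacobi_operator R Y))"

definition two_root :: "('a::euclidean_space \<Rightarrow> 'a \<Rightarrow> 'a \<Rightarrow> 'a \<Rightarrow> real) \<Rightarrow> bool" where
  "two_root R \<longleftrightarrow>
     (\<forall>X. X \<noteq> 0 \<longrightarrow> card (eigenvalues_on (orthogonal_comp {X}) (jacobi_operator R X)) = 2)"

definition jacobi_orthogonal :: "('a::euclidean_space \<Rightarrow> 'a \<Rightarrow> 'a \<Rightarrow> 'a \<Rightarrow> real) \<Rightarrow> bool" where
  "jacobi_orthogonal R \<longleftrightarrow>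
     (\<forall>X Y. X \<bullet> Y = 0 \<longrightarrow> jacobi_operator R X Y \<bullet> jacobi_operator R Y X = 0)"

lemma inner_curvature_operator:
  assumes "algebraic_curvature_tensor R"
  shows "curvature_operator R X Y Z \<bullet> W = R X Y Z W"
proof -
  have lin: "linear (R X Y Z)"
    using assms unfolding algebraic_curvature_tensor_def by blast
  have "\<exists>!V. \<forall>W. V \<bullet> W = R X Y Z W"
  proof (rule ex1I)
    show "\<forall>W. adjoint (R X Y Z) 1 \<bullet> W = R X Y Z W"
      using adjoint_works[OF lin, of _ 1] by (simp add: inner_commute)
  next
    fix V assume "\<forall>W. V \<bullet> W = R X Y Z W"
    then show "V = adjoint (R X Y Z) 1"
      using adjoint_works[OF lin, of _ 1] by (intro vector_eq_rdot[THEN iffD1]) (simp add: inner_commute)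
  qed
  from theI'[OF this] show ?thesis
    by (simp add: curvature_operator_def)
qed

lemma linear_jacobi_operator:
  assumes "algebraic_curvature_tensor R"
  shows "linear (jacobi_operator R X)"
proof (rule linearI)
  have "\<forall>Y Z W. linear (\<lambda>X. R X Y Z W)"
    using assms unfolding algebraic_curvature_tensor_def by (rule conjunct1)
  then have lin: "linear (\<lambda>Y. R Y X X W)" for W
    by simp
  have inner: "jacobi_operator R X Y \<bullet> W = R Y X X W" for Y W
    by (simp only: jacobi_operator_def inner_curvature_operator[OF assms])
  show "jacobi_operator R X (Y + Z) = jacobi_operator R X Y + jacobi_operator R X Z" for Y Z
  proof (rule vector_eq_rdot[THEN iffD1], rule allI)
    fix W
    show "jacobi_operator R X (Y + Z) \<bullet> W = (jacobi_operator R X Y + jacobi_operator R X Z) \<bullet> W"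
      unfolding inner_add_left inner by (rule linear_add[OF lin])
  qed
  show "jacobi_operator R X (c *\<^sub>R Y) = c *\<^sub>R jacobi_operator R X Y" for c Y
  proof (rule vector_eq_rdot[THEN iffD1], rule allI)
    fix W
    show "jacobi_operator R X (c *\<^sub>R Y) \<bullet> W = (c *\<^sub>R jacobi_operator R X Y) \<bullet> W"
      using linear_scale[OF lin] by (simp add: inner)
  qed
qed

lemma jacobi_operator_orthogonal_comp:
  assumes "algebraic_curvature_tensor R"
  shows "jacobi_operator R X ` orthogonal_comp {X} \<subseteq> orthogonal_comp {X}"
proof -
  have "R Y X X X = - R Y X X X" for Y
    using assms unfolding algebraic_curvature_tensor_def by blast
  then have "R Y X X X = 0" for Y
    by (metis equal_neg_zero)
  then show ?thesis
    by (auto simp: orthogonal_comp_def real_inner_class.orthogonal_def jacobi_operator_def inner_commute[of X]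
        inner_curvature_operator[OF assms])
qed

end

theory Submission
  imports Defs
begin

text \<open>
  Equal characteristic polynomials have equal roots, so for an Osserman two-root tensor all
  reduced Jacobi operators of unit vectors have the same two eigenvalues \<open>l\<close> and \<open>m\<close>
  (\<open>eigenvalues_on_eq_roots\<close>, \<open>reduced_jacobi_eigenvalues_eq\<close>). Since these operators are
  self-adjoint, \<open>X\<^sup>\<bottom>\<close> is the orthogonal sum of the two eigenspaces
  (\<open>two_eigenvalues_decomposition\<close>), and both \<open>l\<close> and \<open>m\<close> are extreme values of the Rayleigh
  quotient, attained only at eigenvectors (\<open>two_eigenvalues_rayleigh_eigenvector\<close>).

  For orthonormal \<open>X\<close> and \<open>Y\<close>, both \<open>J\<^sub>X Y \<bullet> Y\<close> and \<open>J\<^sub>Y X \<bullet> X\<close> are the sectional curvature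
  \<open>R Y X X Y\<close>. Hence if \<open>Y\<close> is an eigenvector of \<open>J\<^sub>X\<close>, then \<open>X\<close> attains the same extreme value for
  \<open>J\<^sub>Y\<close> and is an eigenvector of \<open>J\<^sub>Y\<close> for the same eigenvalue (\<open>two_root_duality\<close>).

  Finally let \<open>X\<close> be a unit vector and write \<open>Y \<in> X\<^sup>\<bottom>\<close> as \<open>A + B\<close> with \<open>J\<^sub>X A = l A\<close> and
  \<open>J\<^sub>X B = m B\<close>. By duality \<open>J\<^sub>A X\<close> and \<open>J\<^sub>B X\<close> are multiples of \<open>X\<close>, hence orthogonal to \<open>A\<close>
  and \<open>B\<close>. Every term in the expansion of \<open>J\<^sub>Y X \<bullet> A = R X (A + B) (A + B) A\<close> is zero, either by this
  or by skew symmetry, and likewise for \<open>B\<close>. So \<open>J\<^sub>Y X\<close> is orthogonal to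
  \<open>J\<^sub>X Y = l A + m B\<close> (\<open>jacobi_orthogonal_unit\<close>); homogeneity in \<open>X\<close> gives the general case.
\<close>

section \<open>Eigenvalues as roots of the characteristic polynomial\<close>

definition coord_vec :: "'a::euclidean_space list \<Rightarrow> 'a \<Rightarrow> real Matrix.vec" where
  "coord_vec bs v = vec (length bs) (\<lambda>i. representation (set bs) v (bs ! i))"

definition lin_comb :: "'a::euclidean_space list \<Rightarrow> real Matrix.vec \<Rightarrow> 'a" where
  "lin_comb bs x = (\<Sum>i<length bs. vec_index x i *\<^sub>R (bs ! i))"

lemma lin_comb_coord_vec:
  assumes "ordered_basis bs S" "v \<in> S"
  shows "lin_comb bs (coord_vec bs v) = v"
  using sum_representation_ordered_basis[OF assms] by (simp add: lin_comb_def coord_vec_def)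

lemma ordered_basis_nth_in:
  assumes "ordered_basis bs S" "i < length bs"
  shows "bs ! i \<in> S"
  using assms by (auto simp: ordered_basis_def intro: span_base)

lemma lin_comb_in:
  assumes "ordered_basis bs S"
  shows "lin_comb bs x \<in> S"
proof -
  have "subspace S"
    using assms by (auto simp: ordered_basis_def)
  then show ?thesis
    unfolding lin_comb_def
    by (intro subspace_sum subspace_scale) (auto intro: ordered_basis_nth_in[OF assms])
qed

lemma representation_linear_lin_comb:
  assumes bs: "ordered_basis bs S" and f: "linear f" "f ` S \<subseteq> S"
  shows "representation (set bs) (f (lin_comb bs x)) b =
    (\<Sum>k<length bs. vec_index x k * representation (set bs) (f (bs ! k)) b)"
proof -
  have ind: "independent (set bs)"
    using bs by (simp add: ordered_basis_def)
  have fbs: "f (bs ! k) \<in> span (set bs)" if "k < length bs" for k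
    using ordered_basis_nth_in[OF bs that] f(2) bs by (auto simp: ordered_basis_def)
  have "f (lin_comb bs x) = (\<Sum>k<length bs. vec_index x k *\<^sub>R f (bs ! k))"
    unfolding lin_comb_def by (simp only: linear_sum[OF f(1)] linear_scale[OF f(1)])
  then have "representation (set bs) (f (lin_comb bs x)) b =
      (\<Sum>k<length bs. representation (set bs) (vec_index x k *\<^sub>R f (bs ! k)) b)"
    by (simp only:) (subst real_vector.representation_sum[OF ind], auto intro: span_scale fbs)
  then show ?thesis
    by (simp add: real_vector.representation_scale[OF ind fbs])
qed

lemma coord_vec_linear_lin_comb:
  assumes "ordered_basis bs S" "linear f" "f ` S \<subseteq> S" "x \<in> carrier_vec (length bs)"
  shows "coord_vec bs (f (lin_comb bs x)) = matrix_wrt bs bs f *\<^sub>v x"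
proof (rule eq_vecI)
  fix i assume "i < dim_vec (matrix_wrt bs bs f *\<^sub>v x)"
  then have "i < length bs"
    by (simp add: matrix_wrt_def)
  then show "vec_index (coord_vec bs (f (lin_comb bs x))) i = vec_index (matrix_wrt bs bs f *\<^sub>v x) i"
    using assms(4)
    by (simp add: coord_vec_def matrix_wrt_def representation_linear_lin_comb[OF assms(1-3)]
        scalar_prod_def lessThan_atLeast0 mult.commute)
qed (simp add: coord_vec_def matrix_wrt_def)

lemma coord_vec_lin_comb:
  assumes "ordered_basis bs S" "x \<in> carrier_vec (length bs)"
  shows "coord_vec bs (lin_comb bs x) = x"
  using coord_vec_linear_lin_comb[OF assms(1) linear_id _ assms(2)] matrix_wrt_id[OF assms(1)] assms(2)
  by simp

text \<open>
  The coordinate map and the linear combination map are inverse to each other and turn \<open>f\<close>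
  on \<open>S\<close> into the matrix of \<open>f\<close>. So eigenvectors correspond, and the known fact for matrices
  carries over.
\<close>

lemma eigenvalues_on_eq_roots:
  assumes S: "subspace S" and f: "linear f" "f ` S \<subseteq> S"
  shows "eigenvalues_on S f = {c. poly (char_poly_on S f) c = 0}"
proof -
  obtain bs where bs: "ordered_basis bs S"
    using ordered_basis_exists[OF S] by blast
  define A where "A = matrix_wrt bs bs f"
  have A: "A \<in> carrier_mat (length bs) (length bs)"
    by (simp add: A_def matrix_wrt_def)
  note mult = coord_vec_linear_lin_comb[OF bs f, folded A_def]
  have "eigenvalue A c \<longleftrightarrow> c \<in> eigenvalues_on S f" for c
  proof
    assume "eigenvalue A c"
    then obtain x where x: "x \<in> carrier_vec (length bs)" "x \<noteq> 0\<^sub>v (length bs)" "A *\<^sub>v x = c \<cdot>\<^sub>v x"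
      using A by (auto simp: eigenvalue_def eigenvector_def)
    have "f (lin_comb bs x) \<in> S"
      using lin_comb_in[OF bs, of x] f(2) by blast
    then have "f (lin_comb bs x) = lin_comb bs (c \<cdot>\<^sub>v x)"
      using lin_comb_coord_vec[OF bs] mult[OF x(1)] x(3) by metis
    also have "\<dots> = c *\<^sub>R lin_comb bs x"
      using x(1) by (simp add: lin_comb_def scaleR_sum_right)
    finally have "f (lin_comb bs x) = c *\<^sub>R lin_comb bs x" .
    moreover have "lin_comb bs x \<noteq> 0"
    proof
      assume "lin_comb bs x = 0"
      with coord_vec_lin_comb[OF bs x(1)] have "x = coord_vec bs 0"
        by simp
      with x(2) show False
        by (auto simp: coord_vec_def real_vector.representation_zero)
    qed
    ultimately show "c \<in> eigenvalues_on S f"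
      using lin_comb_in[OF bs] by (auto simp: eigenvalues_on_def)
  next
    assume "c \<in> eigenvalues_on S f"
    then obtain v where v: "v \<in> S" "v \<noteq> 0" "f v = c *\<^sub>R v"
      by (auto simp: eigenvalues_on_def)
    define x where "x = coord_vec bs v"
    have x: "x \<in> carrier_vec (length bs)"
      by (simp add: x_def coord_vec_def)
    have comb: "lin_comb bs x = v"
      using lin_comb_coord_vec[OF bs v(1)] by (simp add: x_def)
    have ind: "independent (set bs)" "v \<in> span (set bs)"
      using bs v(1) by (auto simp: ordered_basis_def)
    have "A *\<^sub>v x = coord_vec bs (c *\<^sub>R v)"
      using mult[OF x] comb v(3) by simp
    also have "\<dots> = c \<cdot>\<^sub>v x"
      by (rule eq_vecI)
        (simp_all add: x_def coord_vec_def real_vector.representation_scale[OF ind])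
    finally have "A *\<^sub>v x = c \<cdot>\<^sub>v x" .
    moreover have "x \<noteq> 0\<^sub>v (length bs)"
      using comb v(2) by (auto simp: lin_comb_def)
    ultimately show "eigenvalue A c"
      using x A by (auto simp: eigenvalue_def eigenvector_def)
  qed
  then show ?thesis
    using eigenvalue_root_char_poly[OF A] char_poly_on_eq[OF f bs] by (auto simp: A_def)
qed

section \<open>Self-adjoint operators on an invariant subspace\<close>

text \<open>
  A maximizer of \<open>f v \<bullet> v\<close> on the unit sphere of \<open>S\<close> exists by compactness and is an eigenvector
  by the first variation.
\<close>

lemma self_adjoint_has_eigenvector:
  fixes f :: "'a::euclidean_space \<Rightarrow> 'a"
  assumes S: "subspace S" "S \<noteq> {0}" and f: "linear f" "f ` S \<subseteq> S"
    and sym: "\<And>v w. f v \<bullet> w = v \<bullet> f w"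
  obtains v c where "v \<in> S" "v \<noteq> 0" "f v = c *\<^sub>R v"
proof -
  obtain u where u: "u \<in> S" "u \<noteq> 0"
    using S subspace_0 by auto
  have "u /\<^sub>R norm u \<in> S \<inter> sphere 0 1"
    using u S(1) by (simp add: subspace_scale)
  moreover have "compact (S \<inter> sphere 0 1)"
    using S(1) by (simp add: closed_Int_compact closed_subspace)
  moreover have "continuous_on (S \<inter> sphere 0 1) (\<lambda>v. f v \<bullet> v)"
    using f(1) by (intro continuous_intros linear_continuous_on) (simp add: linear_conv_bounded_linear)
  ultimately obtain v where v: "v \<in> S" "norm v = 1"
      and max: "\<And>w. w \<in> S \<Longrightarrow> norm w = 1 \<Longrightarrow> f w \<bullet> w \<le> f v \<bullet> v"
    using continuous_attains_sup[of "S \<inter> sphere 0 1" "\<lambda>v. f v \<bullet> v"] by fastforce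
  define M where "M = f v \<bullet> v"
  define q where "q w = M * (w \<bullet> w) - f w \<bullet> w" for w
  define r where "r = M *\<^sub>R v - f v"
  have q_nonneg: "q w \<ge> 0" if "w \<in> S" for w
  proof (cases "w = 0")
    case False
    have "f (w /\<^sub>R norm w) \<bullet> (w /\<^sub>R norm w) \<le> M"
      unfolding M_def using max[of "w /\<^sub>R norm w"] that S(1) False by (simp add: subspace_scale)
    then have "(f w \<bullet> w) / (norm w)\<^sup>2 \<le> M"
      by (simp add: linear_scale[OF f(1)] power2_eq_square divide_inverse mult_ac)
    then show ?thesis
      using False by (simp add: q_def divide_le_eq power2_norm_eq_inner)
  qed (simp add: q_def linear_0[OF f(1)])
  have r: "r \<in> S"
    using v(1) f(2) S(1) by (auto simp: r_def intro: subspace_diff subspace_scale)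
  \<comment> \<open>First variation: along the line \<open>v + t r\<close> the nonnegative form \<open>q\<close> vanishes at \<open>t = 0\<close>,
    so its linear coefficient \<open>2 (r \<bullet> r)\<close> is zero.\<close>
  have expand: "q (v + t *\<^sub>R r) = 2 * t * (r \<bullet> r) + t\<^sup>2 * q r" for t
  proof -
    have "q (v + t *\<^sub>R r) = q v + 2 * t * (r \<bullet> (M *\<^sub>R v - f v)) + t\<^sup>2 * q r"
      using sym[of r v]
      by (simp add: q_def linear_add[OF f(1)] linear_scale[OF f(1)] inner_commute power2_eq_square
          algebra_simps)
    moreover have "q v = 0"
      using v(2) by (simp add: q_def M_def norm_eq_1)
    ultimately show ?thesis
      by (simp add: r_def)
  qed
  have "r \<bullet> r = 0"
  proof (rule ccontr)
    assume "r \<bullet> r \<noteq> 0"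
    then have rr: "r \<bullet> r > 0"
      by simp
    \<comment> \<open>A negative \<open>t\<close> small enough that the linear term dominates; adding \<open>1\<close> keeps the
      denominator positive.\<close>
    define t where "t = - (r \<bullet> r) / (q r + 1)"
    have qr: "q r \<ge> 0"
      by (rule q_nonneg[OF r])
    have t: "t < 0" "- t * q r \<le> r \<bullet> r"
      using rr qr by (auto simp: t_def divide_simps algebra_simps)
    have "0 \<le> t * (2 * (r \<bullet> r) + t * q r)"
      using q_nonneg[of "v + t *\<^sub>R r"] expand[of t] v(1) r S(1)
      by (simp add: subspace_add subspace_scale power2_eq_square algebra_simps)
    moreover have "t * (2 * (r \<bullet> r) + t * q r) < 0"
      using t rr by (intro mult_neg_pos) linarith+
    ultimately show False
      by simp
  qed
  then have "f v = M *\<^sub>R v"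
    by (simp add: r_def)
  then show thesis
    using that[of v M] v norm_zero by fastforce
qed

text \<open>
  The orthogonal complement in \<open>S\<close> of all eigenvectors is again invariant; if it were nonzero it
  would contain an eigenvector, which would then be orthogonal to itself.
\<close>

lemma self_adjoint_span_eigenvectors:
  fixes f :: "'a::euclidean_space \<Rightarrow> 'a"
  assumes S: "subspace S" and f: "linear f" "f ` S \<subseteq> S"
    and sym: "\<And>v w. f v \<bullet> w = v \<bullet> f w"
  shows "S \<subseteq> span {v \<in> S. \<exists>c. f v = c *\<^sub>R v}"
proof -
  define E where "E = {v \<in> S. \<exists>c. f v = c *\<^sub>R v}"
  define P where "P = S \<inter> {w. \<forall>v\<in>E. v \<bullet> w = 0}"
  have P: "subspace P"
    using S by (auto simp: P_def subspace_def inner_add_right)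
  have fP: "f ` P \<subseteq> P"
    using f(2) by (auto simp: P_def E_def sym[symmetric])
  have "P = {0}"
  proof (rule ccontr)
    assume "P \<noteq> {0}"
    then obtain v c where v: "v \<in> P" "v \<noteq> 0" "f v = c *\<^sub>R v"
      using self_adjoint_has_eigenvector[OF P _ f(1) fP sym] by blast
    then have "v \<in> E"
      by (auto simp: P_def E_def)
    with v show False
      by (auto simp: P_def)
  qed
  have "x \<in> span E" if x: "x \<in> S" for x
  proof -
    obtain y z where yz: "y \<in> span E" "\<And>w. w \<in> span E \<Longrightarrow> real_inner_class.orthogonal z w" "x = y + z"
      using orthogonal_subspace_decomp_exists[of E x] by blast
    have "span E \<subseteq> S"
      using S by (intro span_minimal) (auto simp: E_def)
    then have "z \<in> S"
      using yz(1,3) x S by (metis add_diff_cancel_left' subsetD subspace_diff)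
    then have "z \<in> P"
      using yz(2) by (auto simp: P_def real_inner_class.orthogonal_def inner_commute intro: span_base)
    with \<open>P = {0}\<close> yz show ?thesis
      by simp
  qed
  then show ?thesis
    by (auto simp: E_def)
qed

text \<open>
  The operator \<open>(f - l)(f - m)\<close> kills every eigenvector in \<open>S\<close>, hence all of \<open>S\<close>. So the
  Lagrange projections \<open>(f - m) / (l - m)\<close> and \<open>(l - f) / (l - m)\<close> map \<open>S\<close> into the two eigenspaces,
  and they sum to the identity.
\<close>

lemma two_eigenvalues_decomposition:
  fixes f :: "'a::euclidean_space \<Rightarrow> 'a"
  assumes S: "subspace S" and f: "linear f" "f ` S \<subseteq> S"
    and sym: "\<And>v w. f v \<bullet> w = v \<bullet> f w"
    and ev: "eigenvalues_on S f = {l, m}" "l \<noteq> m" and v: "v \<in> S"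
  obtains a b where "a \<in> S" "b \<in> S" "v = a + b" "f a = l *\<^sub>R a" "f b = m *\<^sub>R b"
proof -
  define h where "h w = f (f w) - (l + m) *\<^sub>R f w + (l * m) *\<^sub>R w" for w
  have "linear h"
    unfolding h_def using f(1)
    by (intro linear_compose_add linear_compose_sub linear_compose_scale_right linear_id[unfolded id_def]
        linear_compose[OF f(1) f(1), unfolded o_def])
  moreover have "h w = 0" if w: "w \<in> {w \<in> S. \<exists>c. f w = c *\<^sub>R w}" for w
  proof (cases "w = 0")
    case False
    obtain c where c: "f w = c *\<^sub>R w" "w \<in> S"
      using w by blast
    with False have "c \<in> eigenvalues_on S f"
      by (auto simp: eigenvalues_on_def)
    then have "c = l \<or> c = m"
      using ev(1) by simp
    with c(1) show ?thesis
      by (auto simp: h_def linear_scale[OF f(1)] algebra_simps)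
  qed (simp add: h_def linear_0[OF f(1)])
  ultimately have "h v = 0"
    using self_adjoint_span_eigenvectors[OF S f sym] v
    by (meson linear_eq_0_on_span subsetD)
  then have ffv: "f (f v) = (l + m) *\<^sub>R f v - (l * m) *\<^sub>R v"
    by (simp add: h_def algebra_simps)
  define a where "a = (1 / (l - m)) *\<^sub>R (f v - m *\<^sub>R v)"
  define b where "b = (1 / (l - m)) *\<^sub>R (l *\<^sub>R v - f v)"
  show thesis
  proof (rule that)
    have "f v \<in> S"
      using v f(2) by auto
    then show "a \<in> S" "b \<in> S"
      using v S by (auto simp: a_def b_def intro!: subspace_diff subspace_scale)
    have "a + b = (1 / (l - m)) *\<^sub>R ((l - m) *\<^sub>R v)"
      unfolding a_def b_def scaleR_add_right[symmetric] by (simp add: algebra_simps)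
    then show "v = a + b"
      using ev(2) by simp
    show "f a = l *\<^sub>R a" "f b = m *\<^sub>R b"
      by (simp_all add: a_def b_def linear_scale[OF f(1)] linear_diff[OF f(1)] ffv algebra_simps)
  qed
qed

text \<open>
  With \<open>v = a + b\<close> split into orthogonal eigenvectors, \<open>f v \<bullet> v - l (v \<bullet> v) = (m - l) (b \<bullet> b)\<close>,
  so the hypothesis forces \<open>b = 0\<close>. This is where it matters that there are only two eigenvalues:
  an eigenvalue strictly between two others is also the Rayleigh quotient of vectors that are not
  eigenvectors.
\<close>

lemma two_eigenvalues_rayleigh_eigenvector:
  fixes f :: "'a::euclidean_space \<Rightarrow> 'a"
  assumes "subspace S" "linear f" "f ` S \<subseteq> S"
    and sym: "\<And>v w. f v \<bullet> w = v \<bullet> f w"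
    and ev: "eigenvalues_on S f = {l, m}" "l \<noteq> m"
    and v: "v \<in> S" "f v \<bullet> v = l * (v \<bullet> v)"
  shows "f v = l *\<^sub>R v"
proof -
  obtain a b where ab: "v = a + b" "f a = l *\<^sub>R a" "f b = m *\<^sub>R b"
    using two_eigenvalues_decomposition[OF assms(1-3) sym ev v(1)] by metis
  have "l * (a \<bullet> b) = m * (a \<bullet> b)"
    using sym[of a b] ab by simp
  then have "a \<bullet> b = 0"
    using ev(2) by simp
  then have "(m - l) * (b \<bullet> b) = 0"
    using v(2) ab by (simp add: linear_add[OF assms(2)] inner_commute algebra_simps)
  then show ?thesis
    using ab ev(2) by simp
qed

section \<open>Jacobi operators\<close>

lemma mem_orthogonal_comp_singleton: "Y \<in> orthogonal_comp {X} \<longleftrightarrow> X \<bullet> Y = 0"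
  for X Y :: "'a::euclidean_space"
  by (auto simp: orthogonal_comp_def real_inner_class.orthogonal_def)

context
  fixes R :: "'a::euclidean_space \<Rightarrow> 'a \<Rightarrow> 'a \<Rightarrow> 'a \<Rightarrow> real"
  assumes R: "algebraic_curvature_tensor R"
begin

lemma curvature_linear:
  "linear (\<lambda>X. R X Y Z W)" "linear (\<lambda>Y. R X Y Z W)" "linear (\<lambda>Z. R X Y Z W)"
proof -
  have "\<forall>Y Z W. linear (\<lambda>X. R X Y Z W)" "\<forall>X Z W. linear (\<lambda>Y. R X Y Z W)"
      "\<forall>X Y W. linear (\<lambda>Z. R X Y Z W)"
    using R unfolding algebraic_curvature_tensor_def by - (elim conjE, assumption)+
  then show "linear (\<lambda>X. R X Y Z W)" "linear (\<lambda>Y. R X Y Z W)" "linear (\<lambda>Z. R X Y Z W)"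
    by simp_all
qed

lemma curvature_skew_left: "R X Y Z W = - R Y X Z W"
  using R unfolding algebraic_curvature_tensor_def by blast

lemma curvature_skew_right: "R X Y Z W = - R X Y W Z"
  using R unfolding algebraic_curvature_tensor_def by blast

lemma curvature_pair_symmetry: "R X Y Z W = R Z W X Y"
  using R unfolding algebraic_curvature_tensor_def by blast

lemma inner_jacobi_operator: "jacobi_operator R X Y \<bullet> W = R Y X X W"
  by (simp add: jacobi_operator_def inner_curvature_operator[OF R])

lemma jacobi_operator_self_adjoint:
  "jacobi_operator R X Y \<bullet> W = Y \<bullet> jacobi_operator R X W"
proof -
  have "R Y X X W = R X W Y X" "R W X X Y = - R W X Y X" "R W X Y X = - R X W Y X"
    using curvature_pair_symmetry curvature_skew_right curvature_skew_left by blast+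
  then show ?thesis
    by (simp add: inner_jacobi_operator inner_commute[of Y])
qed

lemma jacobi_operator_scaleR:
  "jacobi_operator R (c *\<^sub>R X) Y = c\<^sup>2 *\<^sub>R jacobi_operator R X Y"
proof (rule vector_eq_rdot[THEN iffD1], rule allI)
  show "jacobi_operator R (c *\<^sub>R X) Y \<bullet> W = (c\<^sup>2 *\<^sub>R jacobi_operator R X Y) \<bullet> W" for W
    by (simp add: inner_jacobi_operator linear_scale[OF curvature_linear(2)]
        linear_scale[OF curvature_linear(3)] power2_eq_square)
qed

lemma reduced_jacobi_eigenvalues_eq:
  assumes "osserman R" "norm X = 1" "norm Y = 1"
  shows "eigenvalues_on (orthogonal_comp {X}) (jacobi_operator R X) =
    eigenvalues_on (orthogonal_comp {Y}) (jacobi_operator R Y)"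
proof -
  have roots: "eigenvalues_on (orthogonal_comp {Z}) (jacobi_operator R Z) =
      {c. poly (char_poly_on (orthogonal_comp {Z}) (jacobi_operator R Z)) c = 0}" for Z
    by (rule eigenvalues_on_eq_roots[OF subspace_orthogonal_comp linear_jacobi_operator[OF R]
          jacobi_operator_orthogonal_comp[OF R]])
  have "char_poly_on (orthogonal_comp {X}) (jacobi_operator R X) =
      char_poly_on (orthogonal_comp {Y}) (jacobi_operator R Y)"
    using assms unfolding osserman_def by blast
  then show ?thesis
    by (simp only: roots)
qed

text \<open>
  For a unit vector \<open>U\<close> in the direction of \<open>Y\<close>, the pair symmetry \<open>R X U U X = R U X X U\<close> says
  that \<open>X\<close> has Rayleigh quotient \<open>l\<close> for \<open>J\<^sub>U\<close>, so it is an eigenvector. The factor \<open>Y \<bullet> Y\<close>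
  comes from \<open>J\<close> being quadratic in its subscript. The roles of \<open>l\<close> and \<open>m\<close> can be
  exchanged, so the statement covers both eigenvalues.
\<close>

lemma two_root_duality:
  assumes ev: "\<And>X. norm X = 1 \<Longrightarrow>
      eigenvalues_on (orthogonal_comp {X}) (jacobi_operator R X) = {l, m}" "l \<noteq> m"
    and X: "norm X = 1" and XY: "X \<bullet> Y = 0" and Y: "jacobi_operator R X Y = l *\<^sub>R Y"
  shows "jacobi_operator R Y X = (l * (Y \<bullet> Y)) *\<^sub>R X"
proof (cases "Y = 0")
  case True
  then show ?thesis
    using jacobi_operator_scaleR[of 0 Y X] by simp
next
  case False
  define U where "U = Y /\<^sub>R norm Y"
  have U: "norm U = 1" "Y = norm Y *\<^sub>R U" "U \<bullet> X = 0"
    using False XY by (auto simp: U_def inner_commute)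
  have "jacobi_operator R X U = l *\<^sub>R U"
    using Y by (simp add: U_def linear_scale[OF linear_jacobi_operator[OF R]])
  then have "R U X X U = l"
    using U(1) by (simp add: inner_jacobi_operator[symmetric] norm_eq_1)
  then have "jacobi_operator R U X \<bullet> X = l * (X \<bullet> X)"
    using X curvature_pair_symmetry[of X U U X] by (simp add: inner_jacobi_operator norm_eq_1)
  then have "jacobi_operator R U X = l *\<^sub>R X"
    using U by (intro two_eigenvalues_rayleigh_eigenvector[OF subspace_orthogonal_comp
          linear_jacobi_operator[OF R] jacobi_operator_orthogonal_comp[OF R]
          jacobi_operator_self_adjoint ev(1) ev(2)])
      (auto simp: mem_orthogonal_comp_singleton)
  then show ?thesis
    using jacobi_operator_scaleR[of "norm Y" U X] U(2)
    by (simp add: power2_norm_eq_inner mult.commute)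
qed

lemma jacobi_orthogonal_unit:
  assumes ev: "\<And>X. norm X = 1 \<Longrightarrow>
      eigenvalues_on (orthogonal_comp {X}) (jacobi_operator R X) = {l, m}" "l \<noteq> m"
    and X: "norm X = 1" and XY: "X \<bullet> Y = 0"
  shows "jacobi_operator R X Y \<bullet> jacobi_operator R Y X = 0"
proof -
  obtain A B where AB: "X \<bullet> A = 0" "X \<bullet> B = 0" "Y = A + B"
      "jacobi_operator R X A = l *\<^sub>R A" "jacobi_operator R X B = m *\<^sub>R B"
    using two_eigenvalues_decomposition[OF subspace_orthogonal_comp linear_jacobi_operator[OF R]
        jacobi_operator_orthogonal_comp[OF R] jacobi_operator_self_adjoint ev(1)[OF X] ev(2)] XY
    by (metis mem_orthogonal_comp_singleton)
  have dualA: "jacobi_operator R A X = (l * (A \<bullet> A)) *\<^sub>R X"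
    by (rule two_root_duality[OF ev X AB(1,4)])
  have dualB: "jacobi_operator R B X = (m * (B \<bullet> B)) *\<^sub>R X"
    using ev by (intro two_root_duality[OF _ _ X AB(2,5)]) (auto simp: insert_commute)
  \<comment> \<open>Stated for \<open>C\<close> and \<open>D\<close> so that it applies to \<open>A, B\<close> in either order.\<close>
  have vanish: "jacobi_operator R (C + D) X \<bullet> C = 0"
    if "jacobi_operator R C X = c *\<^sub>R X" "jacobi_operator R D X = d *\<^sub>R X" "X \<bullet> C = 0" "X \<bullet> D = 0"
    for C D c d
  proof -
    have "R X C C D = 0" "R X D D C = 0" "R X C C C = 0"
      using that by (simp_all add: inner_jacobi_operator[symmetric])
    moreover have "R X D C C = 0"
      using curvature_skew_right[of X D C C] by simp
    moreover have "R X C D C = - R X C C D"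
      by (rule curvature_skew_right)
    ultimately show ?thesis
      by (simp add: inner_jacobi_operator linear_add[OF curvature_linear(2)]
          linear_add[OF curvature_linear(3)])
  qed
  have "jacobi_operator R Y X \<bullet> A = 0" "jacobi_operator R Y X \<bullet> B = 0"
    using vanish[OF dualA dualB] vanish[OF dualB dualA] AB by (auto simp: add.commute)
  then show ?thesis
    using AB by (simp add: linear_add[OF linear_jacobi_operator[OF R]] inner_commute inner_add_right)
qed

end

theorem theorem3:
  fixes R :: "'a::euclidean_space \<Rightarrow> 'a \<Rightarrow> 'a \<Rightarrow> 'a \<Rightarrow> real"
  assumes "algebraic_curvature_tensor R"
    and "osserman R"
    and "two_root R"
  shows "jacobi_orthogonal R"
proof -
  note R = assms(1)
  obtain b :: 'a where b: "b \<in> Basis"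
    using nonempty_Basis by blast
  obtain l m where lm: "eigenvalues_on (orthogonal_comp {b}) (jacobi_operator R b) = {l, m}" "l \<noteq> m"
    using assms(3) b nonzero_Basis[OF b] by (auto simp: two_root_def card_2_iff)
  have ev: "eigenvalues_on (orthogonal_comp {X}) (jacobi_operator R X) = {l, m}" if "norm X = 1" for X
    using reduced_jacobi_eigenvalues_eq[OF R assms(2) that norm_Basis[OF b]] lm(1) by simp
  show ?thesis
    unfolding jacobi_orthogonal_def
  proof (intro allI impI)
    fix X Y :: 'a
    assume XY: "X \<bullet> Y = 0"
    show "jacobi_operator R X Y \<bullet> jacobi_operator R Y X = 0"
    proof (cases "X = 0")
      case True
      then show ?thesis
        by (simp add: linear_0[OF linear_jacobi_operator[OF R]])
    next
      case False
      define U where "U = X /\<^sub>R norm X"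
      have U: "norm U = 1" "X = norm X *\<^sub>R U" "U \<bullet> Y = 0"
        using False XY by (auto simp: U_def)
      have "jacobi_operator R U Y \<bullet> jacobi_operator R Y U = 0"
        by (rule jacobi_orthogonal_unit[OF R ev lm(2) U(1,3)])
      then show ?thesis
        by (subst (1 2) U(2))
          (simp add: jacobi_operator_scaleR[OF R] linear_scale[OF linear_jacobi_operator[OF R]])
    qed
  qed
qed

end
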